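(* Let $\lambda\ge\omega$ be a cardinal and let $k,r\in\omega$. Then every hypergraph $\mathcal E\subseteq[\lambda]^{\omega}$ (every edge a countably infinite subset of $\lambda$) possessing property $C(r,k)$ has a maximizing well-ordering.
   Context: A hypergraph is identified with a family $\mathcal E$ of non-empty sets (its edges); its vertex set is $\bigcup\mathcal E$. $[\lambda]^{\omega}$ is the set of subsets of $\lambda$ of cardinality exactly $\omega$. A hypergraph $\mathcal E$ possesses property $C(m,\rho)$ iff $|\bigcap\mathcal E'|<\rho$ for every set $\mathcal E'\subseteq\mathcal E$ of exactly $m$ distinct edges. A maximizing well-ordering of $\mathcal E$ is a well-ordering of $\bigcup\mathcal E$ in which every edge has a maximal element. *)

theory Defs
  imports Main
begin

unbundle cardinal_syntax

text \<open>Cardinals are represented, as in the library, by well-order relations satisfying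
  \<^const>\<open>Card_order\<close>; the underlying set of such a relation is its \<^const>\<open>Field\<close>. The natural number
  \<open>n\<close>, as a cardinal, is \<open>natLeq_on n\<close> (with field \<open>{..<n}\<close>), and \<open>\<omega>\<close> is \<^const>\<open>natLeq\<close>.\<close>

definition subsets_of_card :: "'a set \<Rightarrow> 'b rel \<Rightarrow> 'a set set" where
  "subsets_of_card X \<kappa> = {A. A \<subseteq> X \<and> |A| =o \<kappa>}"

definition hypergraph :: "'a set set \<Rightarrow> bool" where
  "hypergraph E \<longleftrightarrow> {} \<notin> E"

text \<open>The intersection is taken inside the vertex set. This makes a difference only for
  the empty subfamily (the case \<open>m = 0\<close>), where \<open>\<Inter>{}\<close> would be the universe of the type \<open>'a\<close>.\<close>

definition property_C :: "'b rel \<Rightarrow> 'c rel \<Rightarrow> 'a set set \<Rightarrow> bool" where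
  "property_C m \<rho> E \<longleftrightarrow> (\<forall>E'. E' \<subseteq> E \<and> |E'| =o m \<longrightarrow> |\<Union>E \<inter> \<Inter>E'| <o \<rho>)"

definition maximizing_well_ordering :: "'a set set \<Rightarrow> 'a rel \<Rightarrow> bool" where
  "maximizing_well_ordering E R \<longleftrightarrow>
     well_order_on (\<Union>E) R \<and> (\<forall>A\<in>E. \<exists>a\<in>A. \<forall>x\<in>A. (a, x) \<in> R \<longrightarrow> x = a)"

end

theory Submission
  imports Defs "HOL-Library.Countable_Set"
begin

text \<open>Property \<open>C(r, k)\<close> implies that at most \<open>r\<close> edges contain any given \<open>k\<close> vertices. The proof is an
  induction on the cardinality of the vertex set \<open>V\<close>. If \<open>V\<close> is uncountable, it is split into a
  well-ordered sequence of smaller blocks such that every edge has all but finitely many of its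
  vertices in one block and none in later ones; the orders of the blocks are then concatenated.

  If \<open>V\<close> is countable, so is the set of edges \<open>A\<^sub>0, A\<^sub>1, \<dots>\<close>. Let \<open>F\<^sub>n\<close> be a maximal set of edges that
  contains \<open>A\<^sub>n\<close> and has infinite intersection; it has at most \<open>r\<close> elements. By maximality there are distinct
  points \<open>t\<^sub>n \<in> \<Inter>F\<^sub>n\<close> avoiding all \<open>A\<^sub>i\<close> with \<open>i < n\<close> and \<open>A\<^sub>i \<notin> F\<^sub>n\<close>. Place the points \<open>t\<^sub>n\<close> above
  all other vertices. Up to finitely many points, \<open>A\<close> contains just those \<open>t\<^sub>n\<close> with \<open>A \<in> F\<^sub>n\<close>, so it
  suffices to order the \<open>t\<^sub>n\<close> so that \<open>{t\<^sub>n. A \<in> F\<^sub>n}\<close> has a greatest element for every \<open>A\<close>; this is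
  possible because the sets \<open>F\<^sub>n\<close> are of bounded finite size and cover the set of edges.\<close>

section \<open>Well-founded total relations\<close>

text \<open>Orders are kept strict, as well-founded total relations, hence the exemption
  \<open>x = m\<close>. A reflexive well-ordering is formed only at the end.\<close>

definition has_greatest :: "'a rel \<Rightarrow> 'a set \<Rightarrow> bool" where
  "has_greatest S A \<longleftrightarrow> (\<exists>m\<in>A. \<forall>x\<in>A. x = m \<or> (x, m) \<in> S)"

text \<open>If transitivity failed, totality would give \<open>x = z\<close> or
  \<open>(z, x) \<in> S\<close>, closing a cycle. So transitivity need not be carried along
  separately.\<close>

lemma wf_total_trans:
  assumes "wf S" "total_on V S" "x \<in> V" "z \<in> V" "(x, y) \<in> S" "(y, z) \<in> S"
  shows "(x, z) \<in> S"
proof (rule ccontr)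
  assume neg: "(x, z) \<notin> S"
  have ac: "acyclic S" using assms(1) by (rule wf_acyclic)
  consider "x = z" | "(z, x) \<in> S"
    using neg assms(2-4) by (auto simp: total_on_def)
  then have "(x, x) \<in> S\<^sup>+"
  proof cases
    case 1
    then show ?thesis using assms(5,6) by (meson trancl.simps)
  next
    case 2
    then show ?thesis using assms(5,6) by (meson trancl.simps)
  qed
  then show False using ac by (auto simp: acyclic_def)
qed

text \<open>This is why finitely many vertices of an edge can be neglected: an added point stays
  below the greatest element or, by transitivity, replaces it.\<close>

lemma has_greatest_finite_Un:
  assumes "wf S" "total_on V S" "has_greatest S A" "finite B" "A \<subseteq> V" "B \<subseteq> V"
  shows "has_greatest S (A \<union> B)"
  using assms(4,6)
proof (induction B)
  case empty
  then show ?case using assms(3) by simp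
next
  case (insert b B)
  then obtain m where m: "m \<in> A \<union> B" "\<And>x. x \<in> A \<union> B \<Longrightarrow> x = m \<or> (x, m) \<in> S"
    by (auto simp: has_greatest_def)
  have V: "A \<union> B \<subseteq> V" "b \<in> V" using insert.prems assms(5) by auto
  consider "b = m" | "(b, m) \<in> S" | "(m, b) \<in> S"
    using assms(2) V m(1) by (auto simp: total_on_def)
  then show ?case
  proof cases
    case 3
    have "x = b \<or> (x, b) \<in> S" if "x \<in> A \<union> insert b B" for x
      using that m(2)[of x] 3 wf_total_trans[OF assms(1,2), of x b m] V by blast
    then show ?thesis unfolding has_greatest_def by blast
  qed (use m in \<open>unfold has_greatest_def; blast\<close>)+
qed

lemma ex_wf_total: "\<exists>S :: 'a rel. wf S \<and> total_on UNIV S"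
proof -
  obtain r :: "'a rel" where r: "well_order_on UNIV r" using well_order_on by blast
  then have "wf (r - Id)" "total_on UNIV (r - Id)"
    by (auto simp: well_order_on_def linear_order_on_def total_on_def)
  then show ?thesis by blast
qed

definition lex_sum :: "('a \<Rightarrow> 'i) \<Rightarrow> 'i rel \<Rightarrow> ('i \<Rightarrow> 'a rel) \<Rightarrow> 'a rel" where
  "lex_sum \<rho> R S = {(x, y). (\<rho> x, \<rho> y) \<in> R \<or> \<rho> x = \<rho> y \<and> (x, y) \<in> S (\<rho> x)}"

lemma wf_lex_sum:
  fixes \<rho> :: "'a \<Rightarrow> 'i"
  assumes "wf R" "\<And>i. wf (S i)"
  shows "wf (lex_sum \<rho> R S)"
proof (rule wfI_min)
  fix x and Q :: "'a set"
  assume "x \<in> Q"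
  then obtain i where i: "i \<in> \<rho> ` Q" "\<And>j. (j, i) \<in> R \<Longrightarrow> j \<notin> \<rho> ` Q"
    using wfE_min[OF assms(1), of "\<rho> x" "\<rho> ` Q"] by blast
  then obtain y where "y \<in> {y\<in>Q. \<rho> y = i}" by blast
  from wfE_min[OF assms(2)[of i] this]
  obtain z where z: "z \<in> {y\<in>Q. \<rho> y = i}" "\<And>y. (y, z) \<in> S i \<Longrightarrow> y \<notin> {y\<in>Q. \<rho> y = i}"
    by blast
  then have "y \<notin> Q" if "(y, z) \<in> lex_sum \<rho> R S" for y
    using that i(2) unfolding lex_sum_def by force
  with z(1) show "\<exists>z\<in>Q. \<forall>y. (y, z) \<in> lex_sum \<rho> R S \<longrightarrow> y \<notin> Q" by blast
qed

lemma total_on_lex_sum: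
  assumes "total_on (\<rho> ` V) R" "\<And>i. i \<in> \<rho> ` V \<Longrightarrow> total_on {x\<in>V. \<rho> x = i} (S i)"
  shows "total_on V (lex_sum \<rho> R S)"
  unfolding total_on_def
proof (intro ballI impI)
  fix x y assume xy: "x \<in> V" "y \<in> V" "x \<noteq> y"
  show "(x, y) \<in> lex_sum \<rho> R S \<or> (y, x) \<in> lex_sum \<rho> R S"
  proof (cases "\<rho> x = \<rho> y")
    case True
    then show ?thesis using xy assms(2)[of "\<rho> x"] by (auto simp: total_on_def lex_sum_def)
  next
    case False
    then show ?thesis using xy assms(1) by (auto simp: total_on_def lex_sum_def)
  qed
qed

text \<open>All points outside \<open>U\<close> go below \<open>U\<close>. A set that meets
  \<open>U\<close> then has a greatest element as soon as its part in \<open>U\<close> has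
  one.\<close>

lemma wf_total_extend_below:
  assumes "wf S" "total_on U S"
  shows "\<exists>S'. wf S' \<and> total_on UNIV S' \<and> (\<forall>x y. y \<in> U \<longrightarrow> x \<notin> U \<or> (x, y) \<in> S \<longrightarrow> (x, y) \<in> S')"
proof -
  obtain S0 :: "'a rel" where S0: "wf S0" "total_on UNIV S0" using ex_wf_total by blast
  define S1 where "S1 = lex_sum (\<lambda>x. x \<in> U) {(False, True)} (\<lambda>b. if b then S else S0)"
  have "wf {(False, True)}" unfolding wf_def by simp (metis (full_types))
  then have "wf S1" unfolding S1_def
    by (rule wf_lex_sum) (simp add: assms(1) S0(1))
  moreover have "total_on UNIV S1" unfolding S1_def
    by (rule total_on_lex_sum) (use assms(2) S0(2) in \<open>auto simp: total_on_def\<close>)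
  moreover have "(x, y) \<in> S1" if "y \<in> U" "x \<notin> U \<or> (x, y) \<in> S" for x y
    using that by (auto simp: S1_def lex_sum_def)
  ultimately show ?thesis by blast
qed

section \<open>Covers by sets of bounded finite size\<close>

text \<open>A descending chain of covers may have an intersection that no longer covers, so Zorn's
  lemma is used differently: \<open>M\<close> is a maximal family of sets with pairwise disjoint
  traces of full size on \<open>X\<close>. Off their union all traces have size at most
  \<open>s\<close>, and induction applies.\<close>

lemma bounded_cover_has_minimal_subcover:
  assumes "\<And>t. t \<in> T \<Longrightarrow> finite (X \<inter> \<Phi> t) \<and> card (X \<inter> \<Phi> t) \<le> s" "X \<subseteq> \<Union>(\<Phi> ` T)"
  shows "\<exists>U\<subseteq>T. X \<subseteq> \<Union>(\<Phi> ` U) \<and> (\<forall>t\<in>U. \<exists>x\<in>X \<inter> \<Phi> t. \<forall>u\<in>U. x \<in> \<Phi> u \<longrightarrow> u = t)"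
  using assms
proof (induction s arbitrary: X)
  case 0
  then have "X = {}" by fastforce
  then show ?case by auto
next
  case (Suc s)
  define P where "P = {M. M \<subseteq> {t\<in>T. card (X \<inter> \<Phi> t) = Suc s} \<and>
    (\<forall>t\<in>M. \<forall>u\<in>M. t \<noteq> u \<longrightarrow> X \<inter> \<Phi> t \<inter> \<Phi> u = {})}"
  have "\<exists>M\<in>P. \<forall>N\<in>P. M \<subseteq> N \<longrightarrow> N = M"
  proof (rule subset_Zorn')
    fix C assume C: "subset.chain P C"
    have "X \<inter> \<Phi> t \<inter> \<Phi> u = {}" if tu: "t \<in> \<Union>C" "u \<in> \<Union>C" "t \<noteq> u" for t u
    proof -
      obtain M N where MN: "M \<in> C" "N \<in> C" "t \<in> M" "u \<in> N" using tu by blast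
      then have "M \<subseteq> N \<or> N \<subseteq> M" using C by (auto simp: subset_chain_def)
      with MN obtain L where "L \<in> C" "t \<in> L" "u \<in> L" by blast
      moreover have "L \<in> P" using C \<open>L \<in> C\<close> by (auto simp: subset_chain_def)
      ultimately show ?thesis using tu(3) unfolding P_def by blast
    qed
    moreover have "\<Union>C \<subseteq> {t\<in>T. card (X \<inter> \<Phi> t) = Suc s}"
      using C by (auto simp: subset_chain_def P_def)
    ultimately show "\<Union>C \<in> P" unfolding P_def by blast
  qed
  then obtain M where M: "M \<in> P" "\<And>N. N \<in> P \<Longrightarrow> M \<subseteq> N \<Longrightarrow> N = M" by blast
  define X' where "X' = X - \<Union>(\<Phi> ` M)"
  have "finite (X' \<inter> \<Phi> t) \<and> card (X' \<inter> \<Phi> t) \<le> s" if t: "t \<in> T" for t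
  proof
    show fin: "finite (X' \<inter> \<Phi> t)"
      using Suc.prems(1)[OF t] by (auto simp: X'_def intro: finite_subset[of _ "X \<inter> \<Phi> t"])
    show "card (X' \<inter> \<Phi> t) \<le> s"
    proof (cases "X' \<inter> \<Phi> t = X \<inter> \<Phi> t")
      case False
      then have "X' \<inter> \<Phi> t \<subset> X \<inter> \<Phi> t" by (auto simp: X'_def)
      then have "card (X' \<inter> \<Phi> t) < card (X \<inter> \<Phi> t)"
        using Suc.prems(1)[OF t] by (auto intro: psubset_card_mono)
      then show ?thesis using Suc.prems(1)[OF t] by linarith
    next
      case True
      show ?thesis
      proof (rule ccontr)
        assume "\<not> ?thesis"
        then have card: "card (X \<inter> \<Phi> t) = Suc s" using Suc.prems(1)[OF t] True by simp
        \<comment> \<open>A full trace untouched by \<open>M\<close> can be added to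
          \<open>M\<close>, so by maximality \<open>t\<close> is already in \<open>M\<close>; but
          then it has no points in \<open>X'\<close>.\<close>
        then have "insert t M \<in> P" using M(1) t True by (auto simp: P_def X'_def)
        then have "t \<in> M" using M(2)[of "insert t M"] by blast
        then have "X' \<inter> \<Phi> t = {}" by (auto simp: X'_def)
        then show False using card True by simp
      qed
    qed
  qed
  moreover have "X' \<subseteq> \<Union>(\<Phi> ` T)" using Suc.prems(2) by (auto simp: X'_def)
  ultimately have "\<exists>U\<subseteq>T. X' \<subseteq> \<Union>(\<Phi> ` U) \<and> (\<forall>t\<in>U. \<exists>x\<in>X' \<inter> \<Phi> t. \<forall>u\<in>U. x \<in> \<Phi> u \<longrightarrow> u = t)"
    by (rule Suc.IH)
  then obtain U where U: "U \<subseteq> T" "X' \<subseteq> \<Union>(\<Phi> ` U)"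
    "\<And>t. t \<in> U \<Longrightarrow> \<exists>x\<in>X' \<inter> \<Phi> t. \<forall>u\<in>U. x \<in> \<Phi> u \<longrightarrow> u = t"
    by blast
  \<comment> \<open>Members of \<open>M\<close> made redundant by \<open>U\<close> are dropped. Each
    remaining one has a point not covered by \<open>U\<close>, private by disjointness; the private
    points for \<open>U\<close> lie in \<open>X'\<close>, which \<open>M\<close> avoids.\<close>
  define M' where "M' = {m\<in>M. \<not> X \<inter> \<Phi> m \<subseteq> \<Union>(\<Phi> ` U)}"
  have "U \<union> M' \<subseteq> T" using U(1) M(1) by (auto simp: M'_def P_def)
  moreover have "X \<subseteq> \<Union>(\<Phi> ` (U \<union> M'))"
    using U(2) by (fastforce simp: M'_def X'_def)
  moreover have "\<exists>x\<in>X \<inter> \<Phi> t. \<forall>u\<in>U \<union> M'. x \<in> \<Phi> u \<longrightarrow> u = t" if "t \<in> U" for t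
    using U(3)[OF that] by (fastforce simp: M'_def X'_def)
  moreover have "\<exists>x\<in>X \<inter> \<Phi> t. \<forall>u\<in>U \<union> M'. x \<in> \<Phi> u \<longrightarrow> u = t" if t: "t \<in> M'" for t
  proof -
    obtain x where x: "x \<in> X \<inter> \<Phi> t" "x \<notin> \<Union>(\<Phi> ` U)" using t by (auto simp: M'_def)
    have "u = t" if "u \<in> M'" "x \<in> \<Phi> u" for u
      using that x(1) t M(1) unfolding M'_def P_def by blast
    with x show ?thesis by blast
  qed
  ultimately show ?case by (intro exI[of _ "U \<union> M'"]) blast
qed

text \<open>In a minimal subcover every set has a private element. Private elements lie in only one set,
  so they impose no condition on the order; deleting them lowers the size bound.\<close>

lemma bounded_cover_order:
  assumes "\<And>t. t \<in> T \<Longrightarrow> finite (X \<inter> \<Phi> t) \<and> card (X \<inter> \<Phi> t) \<le> s" "X \<subseteq> \<Union>(\<Phi> ` T)"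
  shows "\<exists>S. wf S \<and> total_on UNIV S \<and> (\<forall>x\<in>X. has_greatest S {t\<in>T. x \<in> \<Phi> t})"
  using assms
proof (induction s arbitrary: X T)
  case 0
  then have "X = {}" by fastforce
  then show ?case using ex_wf_total by auto
next
  case (Suc s)
  obtain U where U: "U \<subseteq> T" "X \<subseteq> \<Union>(\<Phi> ` U)"
    and priv: "\<And>t. t \<in> U \<Longrightarrow> \<exists>x\<in>X \<inter> \<Phi> t. \<forall>u\<in>U. x \<in> \<Phi> u \<longrightarrow> u = t"
    using bounded_cover_has_minimal_subcover[OF Suc.prems] by blast
  define Y where "Y = {x\<in>X. \<forall>u\<in>U. x \<in> \<Phi> u \<longrightarrow> (\<exists>u'\<in>U. u' \<noteq> u \<and> x \<in> \<Phi> u')}"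
  have "finite (Y \<inter> \<Phi> t) \<and> card (Y \<inter> \<Phi> t) \<le> s" if t: "t \<in> U" for t
  proof -
    have fin: "finite (X \<inter> \<Phi> t)" "card (X \<inter> \<Phi> t) \<le> Suc s" using Suc.prems(1) t U(1) by auto
    have "Y \<inter> \<Phi> t \<subset> X \<inter> \<Phi> t" using priv[OF t] t by (auto simp: Y_def)
    then show ?thesis using fin psubset_card_mono[OF fin(1)] finite_subset[OF _ fin(1)]
      by (metis less_Suc_eq_le order_less_le_trans psubset_imp_subset)
  qed
  moreover have "Y \<subseteq> \<Union>(\<Phi> ` U)" using U(2) by (auto simp: Y_def)
  ultimately obtain S where S: "wf S" "total_on UNIV S"
    "\<And>x. x \<in> Y \<Longrightarrow> has_greatest S {t\<in>U. x \<in> \<Phi> t}"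
    using Suc.IH[of U Y] by blast
  have "total_on U S" using S(2) by (auto simp: total_on_def)
  then obtain S' where S': "wf S'" "total_on UNIV S'"
    "\<And>x y. y \<in> U \<Longrightarrow> x \<notin> U \<or> (x, y) \<in> S \<Longrightarrow> (x, y) \<in> S'"
    using wf_total_extend_below[OF S(1)] by blast
  have "has_greatest S' {t\<in>T. x \<in> \<Phi> t}" if x: "x \<in> X" for x
  proof -
    have "has_greatest S {t\<in>U. x \<in> \<Phi> t}"
    proof (cases "x \<in> Y")
      case False
      then show ?thesis using x U(2) unfolding Y_def has_greatest_def by fastforce
    qed (rule S(3))
    then obtain m where m: "m \<in> U" "x \<in> \<Phi> m" "\<And>t. t \<in> U \<Longrightarrow> x \<in> \<Phi> t \<Longrightarrow> t = m \<or> (t, m) \<in> S"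
      unfolding has_greatest_def by blast
    \<comment> \<open>Indices in \<open>T - U\<close> lie below all of \<open>U\<close>, so the
      greatest index found in \<open>U\<close> is greatest in \<open>T\<close>.\<close>
    have "t = m \<or> (t, m) \<in> S'" if "t \<in> T" "x \<in> \<Phi> t" for t
      using m(3)[OF _ that(2)] S'(3)[OF m(1), of t] by blast
    with m(1,2) U(1) show ?thesis unfolding has_greatest_def by blast
  qed
  with S'(1,2) show ?case by blast
qed

section \<open>Countable vertex sets\<close>

text \<open>Property C read dually: it bounds the edges through \<open>k\<close> points. Finiteness
  is stated separately because \<open>card\<close> of an infinite set is 0.\<close>

definition bounded_codegree :: "nat \<Rightarrow> nat \<Rightarrow> 'a set set \<Rightarrow> bool" where
  "bounded_codegree k r E \<longleftrightarrow>
     (\<forall>K. finite K \<and> card K = k \<longrightarrow> finite {A\<in>E. K \<subseteq> A} \<and> card {A\<in>E. K \<subseteq> A} \<le> r)"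

text \<open>A family with infinite intersection has \<open>k\<close> common points, hence at most
  \<open>r\<close> members. So among such families containing \<open>A\<close> one has greatest
  cardinality.\<close>

lemma bounded_codegree_maximal_family:
  assumes "bounded_codegree k r E" "\<And>A. A \<in> E \<Longrightarrow> infinite A" "A \<in> E"
  shows "\<exists>F\<subseteq>E. A \<in> F \<and> finite F \<and> card F \<le> r \<and> infinite (\<Inter>F) \<and>
    (\<forall>B\<in>E - F. finite (\<Inter>F \<inter> B))"
proof -
  define P where "P F \<longleftrightarrow> F \<subseteq> E \<and> A \<in> F \<and> infinite (\<Inter>F)" for F
  have bound: "finite F \<and> card F \<le> r" if "P F" for F
  proof -
    have "infinite (\<Inter>F)" using that by (simp add: P_def)
    then obtain K where K: "K \<subseteq> \<Inter>F" "finite K" "card K = k"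
      using infinite_arbitrarily_large[of "\<Inter>F" k] by auto
    have "F \<subseteq> {A\<in>E. K \<subseteq> A}" using K(1) that by (auto simp: P_def)
    moreover have "finite {A\<in>E. K \<subseteq> A}" "card {A\<in>E. K \<subseteq> A} \<le> r"
      using assms(1) K(2,3) by (auto simp: bounded_codegree_def)
    ultimately show ?thesis using card_mono finite_subset order_trans by metis
  qed
  have "P {A}" using assms(2,3) by (auto simp: P_def)
  then obtain F where F: "P F" "\<And>G. P G \<Longrightarrow> card G \<le> card F"
    using ex_has_greatest_nat[of P "{A}" card "Suc r"] bound by (metis less_Suc_eq_le)
  have "finite (\<Inter>F \<inter> B)" if "B \<in> E - F" for B
  proof (rule ccontr)
    assume "infinite (\<Inter>F \<inter> B)"
    then have "P (insert B F)" using F(1) that by (auto simp: P_def Int_commute)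
    then show False using F(2)[of "insert B F"] bound[OF F(1)] that by simp
  qed
  with F(1) bound[OF F(1)] show ?thesis unfolding P_def by blast
qed

text \<open>Each edge contains one of the countably many \<open>k\<close>-subsets of
  \<open>V\<close>, and each of these lies in finitely many edges.\<close>

lemma bounded_codegree_countable:
  assumes "bounded_codegree k r E" "countable V" "\<And>A. A \<in> E \<Longrightarrow> infinite A \<and> A \<subseteq> V"
  shows "countable E"
proof -
  have "E \<subseteq> (\<Union>K\<in>{K. finite K \<and> K \<subseteq> V} \<inter> {K. card K = k}. {A\<in>E. K \<subseteq> A})"
  proof
    fix A assume A: "A \<in> E"
    then obtain K where "K \<subseteq> A" "finite K" "card K = k"
      using infinite_arbitrarily_large assms(3) by metis
    then show "A \<in> (\<Union>K\<in>{K. finite K \<and> K \<subseteq> V} \<inter> {K. card K = k}. {A\<in>E. K \<subseteq> A})"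
      using A assms(3) by blast
  qed
  moreover have "countable (\<Union>K\<in>{K. finite K \<and> K \<subseteq> V} \<inter> {K. card K = k}. {A\<in>E. K \<subseteq> A})"
    using assms(1) countable_Collect_finite_subset[OF assms(2)]
    by (intro countable_UN countable_Int1) (auto simp: bounded_codegree_def intro: countable_finite)
  ultimately show ?thesis by (rule countable_subset)
qed

lemma maximizing_order_countable:
  assumes "bounded_codegree k r E" "countable V" "\<And>A. A \<in> E \<Longrightarrow> infinite A \<and> A \<subseteq> V"
  shows "\<exists>S. wf S \<and> total_on UNIV S \<and> (\<forall>A\<in>E. has_greatest S A)"
proof (cases "E = {}")
  case True
  then show ?thesis using ex_wf_total by auto
next
  case False
  define A where "A = from_nat_into E"
  have A: "range A = E" unfolding A_def
    using False bounded_codegree_countable[OF assms] by (rule range_from_nat_into)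
  have "\<forall>n. \<exists>F\<subseteq>E. A n \<in> F \<and> finite F \<and> card F \<le> r \<and> infinite (\<Inter>F) \<and>
    (\<forall>B\<in>E - F. finite (\<Inter>F \<inter> B))"
    using bounded_codegree_maximal_family[OF assms(1)] assms(3) A by blast
  then obtain F where F: "\<And>n. F n \<subseteq> E" "\<And>n. A n \<in> F n" "\<And>n. finite (F n)" "\<And>n. card (F n) \<le> r"
    "\<And>n. infinite (\<Inter>(F n))" "\<And>n B. B \<in> E - F n \<Longrightarrow> finite (\<Inter>(F n) \<inter> B)"
    by metis
  define bad where "bad n = \<Union>{A i | i. i < n \<and> A i \<notin> F n}" for n
  \<comment> \<open>By maximality each of the finitely many edges forming \<open>bad n\<close> meets
    \<open>\<Inter>(F n)\<close> in a finite set, so infinitely many candidates for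
    \<open>t n\<close> remain.\<close>
  have "\<exists>t. \<forall>n::nat. t n \<in> \<Inter>(F n) - bad n \<and> t n \<notin> t ` {..<n}"
  proof (rule dependent_wellorder_choice)
    fix n :: nat and t :: "nat \<Rightarrow> 'a"
    have "\<Inter>(F n) \<inter> bad n = (\<Union>i\<in>{i. i < n \<and> A i \<notin> F n}. \<Inter>(F n) \<inter> A i)"
      by (auto simp: bad_def)
    moreover have "finite \<dots>" using A F(6)[of _ n] by (intro finite_UN_I) auto
    ultimately have "finite (\<Inter>(F n) \<inter> bad n)" by simp
    then have "infinite (\<Inter>(F n) - bad n - t ` {..<n})"
      using F(5)[of n] by (metis Diff_Diff_Int Diff_infinite_finite finite_Diff2 finite_imageI finite_lessThan)
    then have "\<Inter>(F n) - bad n - t ` {..<n} \<noteq> {}" by (metis finite.emptyI)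
    then show "\<exists>x. x \<in> \<Inter>(F n) - bad n \<and> x \<notin> t ` {..<n}" by blast
  qed auto
  then obtain t where t: "\<And>n. t n \<in> \<Inter>(F n)" "\<And>n. t n \<notin> bad n" "\<And>n. t n \<notin> t ` {..<n}"
    by blast
  have inj: "inj t"
    by (rule linorder_injI) (metis imageI lessThan_iff t(3))
  \<comment> \<open>Since \<open>t\<close> is injective, \<open>F\<close> can be indexed by the
    points themselves. In the cover lemma the points are the indices to be ordered, and the edges
    are the covered elements.\<close>
  define \<Phi> where "\<Phi> x = F (inv t x)" for x
  have \<Phi>: "\<Phi> (t n) = F n" for n using inj by (simp add: \<Phi>_def)
  have "\<exists>S. wf S \<and> total_on UNIV S \<and> (\<forall>B\<in>E. has_greatest S {x\<in>range t. B \<in> \<Phi> x})"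
  proof (rule bounded_cover_order)
    show "finite (E \<inter> \<Phi> x) \<and> card (E \<inter> \<Phi> x) \<le> r" if "x \<in> range t" for x
      using that F(1,3,4) by (auto simp: \<Phi> Int_absorb1)
    show "E \<subseteq> \<Union>(\<Phi> ` range t)" using A F(2) by (auto simp: \<Phi>)
  qed
  then obtain S where S: "wf S" "total_on UNIV S"
    "\<And>B. B \<in> E \<Longrightarrow> has_greatest S {x\<in>range t. B \<in> \<Phi> x}" by blast
  have "total_on (range t) S" using S(2) by (auto simp: total_on_def)
  then obtain S' where S': "wf S'" "total_on UNIV S'"
    "\<And>x y. y \<in> range t \<Longrightarrow> x \<notin> range t \<or> (x, y) \<in> S \<Longrightarrow> (x, y) \<in> S'"
    using wf_total_extend_below[OF S(1)] by blast
  have "has_greatest S' B" if B: "B \<in> E" for B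
  proof -
    obtain i where i: "B = A i" using A B by blast
    \<comment> \<open>If \<open>A i\<close> is outside \<open>F n\<close> and \<open>i < n\<close>,
      then \<open>t n\<close> avoids it. So \<open>t n \<in> B\<close> and
      \<open>B \<in> F n\<close> are equivalent for all \<open>n > i\<close>.\<close>
    have "n \<le> i" if "t n \<in> B" "B \<notin> F n" for n
    proof (rule ccontr)
      assume "\<not> n \<le> i"
      then have "B \<subseteq> bad n" using that(2) unfolding bad_def i by (intro Union_upper) auto
      then show False using t(2) that(1) by blast
    qed
    then have "{x\<in>range t \<inter> B. B \<notin> \<Phi> x} \<subseteq> t ` {..i}" by (auto simp: \<Phi>)
    then have "finite {x\<in>range t \<inter> B. B \<notin> \<Phi> x}" by (rule finite_subset) simp
    then have "has_greatest S ({x\<in>range t. B \<in> \<Phi> x} \<union> {x\<in>range t \<inter> B. B \<notin> \<Phi> x})"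
      using has_greatest_finite_Un[OF S(1,2) S(3)[OF B]] by simp
    moreover have "{x\<in>range t. B \<in> \<Phi> x} \<union> {x\<in>range t \<inter> B. B \<notin> \<Phi> x} = range t \<inter> B"
      using t(1) by (auto simp: \<Phi>)
    ultimately obtain m where "m \<in> range t \<inter> B" "\<forall>x\<in>range t \<inter> B. x = m \<or> (x, m) \<in> S"
      by (auto simp: has_greatest_def)
    then have "m \<in> B" "\<forall>x\<in>B. x = m \<or> (x, m) \<in> S'" using S'(3)[of m] by blast+
    then show ?thesis unfolding has_greatest_def by blast
  qed
  with S'(1,2) show ?thesis by blast
qed

section \<open>Closed sets of vertices\<close>

definition closure_step :: "nat \<Rightarrow> 'a set set \<Rightarrow> 'a set \<Rightarrow> 'a set" where
  "closure_step k E X = X \<union> \<Union>{A\<in>E. \<exists>K\<subseteq>X \<inter> A. finite K \<and> card K = k}"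

definition edge_closure :: "nat \<Rightarrow> 'a set set \<Rightarrow> 'a set \<Rightarrow> 'a set" where
  "edge_closure k E X = (\<Union>n. (closure_step k E ^^ n) X)"

lemma subset_edge_closure: "X \<subseteq> edge_closure k E X"
proof -
  have "(closure_step k E ^^ 0) X \<subseteq> edge_closure k E X"
    unfolding edge_closure_def by (rule UN_upper) simp
  then show ?thesis by simp
qed

lemma closure_step_mono: "X \<subseteq> Y \<Longrightarrow> closure_step k E X \<subseteq> closure_step k E Y"
  unfolding closure_step_def by blast

lemma edge_closure_mono:
  assumes "X \<subseteq> Y"
  shows "edge_closure k E X \<subseteq> edge_closure k E Y"
proof -
  have "(closure_step k E ^^ n) X \<subseteq> (closure_step k E ^^ n) Y" for n
    by (induction n) (simp_all add: assms closure_step_mono)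
  then show ?thesis unfolding edge_closure_def by blast
qed

lemma edge_closure_subset:
  assumes "X \<subseteq> V" "\<And>A. A \<in> E \<Longrightarrow> A \<subseteq> V"
  shows "edge_closure k E X \<subseteq> V"
proof -
  have "(closure_step k E ^^ n) X \<subseteq> V" for n
    by (induction n) (use assms in \<open>auto simp: closure_step_def\<close>)
  then show ?thesis unfolding edge_closure_def by blast
qed

lemma finite_subset_mono_UN:
  fixes C :: "nat \<Rightarrow> 'a set"
  assumes "mono C" "finite K" "K \<subseteq> (\<Union>n. C n)"
  shows "\<exists>n. K \<subseteq> C n"
  using assms(2,3)
proof (induction K)
  case (insert x K)
  then obtain m n where "x \<in> C m" "K \<subseteq> C n" by auto
  moreover have "C m \<subseteq> C (max m n)" "C n \<subseteq> C (max m n)" using assms(1) by (auto simp: mono_def)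
  ultimately show ?case by blast
qed auto

text \<open>The stages increase and \<open>K\<close> is finite, so one stage contains
  \<open>K\<close> and the next contains \<open>A\<close>.\<close>

lemma edge_closure_closed:
  assumes "A \<in> E" "K \<subseteq> edge_closure k E X \<inter> A" "finite K" "card K = k"
  shows "A \<subseteq> edge_closure k E X"
proof -
  have "mono (\<lambda>n. (closure_step k E ^^ n) X)"
    by (auto simp: mono_iff_le_Suc closure_step_def)
  then obtain n where "K \<subseteq> (closure_step k E ^^ n) X"
    using finite_subset_mono_UN[of "\<lambda>n. (closure_step k E ^^ n) X" K] assms(2,3)
    unfolding edge_closure_def by blast
  then have "A \<subseteq> (closure_step k E ^^ Suc n) X"
    using assms by (auto simp: closure_step_def)
  then show ?thesis unfolding edge_closure_def by blast
qed

section \<open>Cardinality of closures\<close>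

lemma card_of_lists_of_length:
  assumes "infinite Y" "|X| \<le>o |Y|"
  shows "|{xs. set xs \<subseteq> X \<and> length xs = n}| \<le>o |Y|"
proof (induction n)
  case 0
  have "{xs. set xs \<subseteq> X \<and> length xs = 0} = {[]}" by auto
  then show ?case using assms(1) by (simp add: card_of_singl_ordLeq infinite_imp_nonempty)
next
  case (Suc n)
  have "{xs. set xs \<subseteq> X \<and> length xs = Suc n} =
      (\<Union>x\<in>X. (#) x ` {xs. set xs \<subseteq> X \<and> length xs = n})"
    by (auto simp: length_Suc_conv)
  moreover have "|\<dots>| \<le>o |Y|"
    using Suc card_of_image ordLeq_transitive
    by (intro card_of_UNION_ordLeq_infinite assms) blast
  ultimately show ?case by simp
qed

lemma countable_card_of_ordLeq_infinite:
  assumes "countable A" "infinite Y"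
  shows "|A| \<le>o |Y|"
proof -
  have "|A| \<le>o |UNIV :: nat set|"
    using assms(1) unfolding countable_def card_of_ordLeq[symmetric] by auto
  also have "|UNIV :: nat set| \<le>o |Y|"
    using assms(2) infinite_iff_card_of_nat by blast
  finally show ?thesis .
qed

lemma card_of_Un_ordLeq_infinite:
  assumes "infinite Y" "|A| \<le>o |Y|" "|B| \<le>o |Y|"
  shows "|A \<union> B| \<le>o |Y|"
  by (rule card_of_Un_ordLeq_infinite_Field[OF _ assms(2,3) card_of_Card_order])
    (simp add: assms(1) Field_card_of)

text \<open>One step adds the edges through \<open>k\<close>-subsets of \<open>Z\<close>: at most
  \<open>|Y|\<close> subsets, each in finitely many countable edges. Countably many steps preserve
  the bound.\<close>

lemma card_of_edge_closure:
  assumes "bounded_codegree k r E" "\<And>A. A \<in> E \<Longrightarrow> countable A" "infinite Y" "|X| \<le>o |Y|"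
  shows "|edge_closure k E X| \<le>o |Y|"
proof -
  have step: "|closure_step k E Z| \<le>o |Y|" if Z: "|Z| \<le>o |Y|" for Z
  proof -
    let ?L = "{xs. set xs \<subseteq> Z \<and> length xs = k}"
    \<comment> \<open>Lists of length \<open>k\<close> code the \<open>k\<close>-subsets. The guard
      excludes lists with repetitions, whose fewer points may lie in too many edges.\<close>
    let ?E = "\<lambda>xs. if card (set xs) = k then {A\<in>E. set xs \<subseteq> A} else {}"
    have sub: "closure_step k E Z \<subseteq> Z \<union> (\<Union>xs\<in>?L. \<Union>(?E xs))"
    proof
      fix x assume "x \<in> closure_step k E Z"
      then consider "x \<in> Z" | A K where "A \<in> E" "x \<in> A" "K \<subseteq> Z \<inter> A" "finite K" "card K = k"
        unfolding closure_step_def by blast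
      then show "x \<in> Z \<union> (\<Union>xs\<in>?L. \<Union>(?E xs))"
      proof cases
        case 2
        obtain xs where "set xs = K" "length xs = k"
          using finite_distinct_list[OF 2(4)] 2(5) distinct_card by metis
        with 2 have "xs \<in> ?L" "A \<in> ?E xs" by auto
        with \<open>x \<in> A\<close> show ?thesis by blast
      qed simp
    qed
    have "countable (\<Union>(?E xs))" for xs
    proof -
      have "finite (?E xs)" using assms(1) by (auto simp: bounded_codegree_def)
      then have "countable (\<Union>A\<in>?E xs. A)"
        using assms(2) by (intro countable_UN) (auto intro: countable_finite split: if_splits)
      then show ?thesis by simp
    qed
    then have "|\<Union>xs\<in>?L. \<Union>(?E xs)| \<le>o |Y|"
      by (intro card_of_UNION_ordLeq_infinite assms(3) card_of_lists_of_length Z ballI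
          countable_card_of_ordLeq_infinite)
    then have "|Z \<union> (\<Union>xs\<in>?L. \<Union>(?E xs))| \<le>o |Y|"
      by (intro card_of_Un_ordLeq_infinite assms(3) Z)
    with card_of_mono1[OF sub] show ?thesis by (rule ordLeq_transitive)
  qed
  have "|(closure_step k E ^^ n) X| \<le>o |Y|" for n
    by (induction n) (simp_all add: assms(4) step)
  then show ?thesis unfolding edge_closure_def
    using assms(3) by (intro card_of_UNION_ordLeq_infinite) (auto simp: infinite_iff_card_of_nat[symmetric])
qed

text \<open>The closure bound needs an infinite comparison set. For a finite initial segment this is
  \<open>nat\<close>, smaller than the uncountable \<open>V\<close>; otherwise it is the segment
  itself, smaller than \<open>V\<close> since \<open>|V|\<close> is a cardinal order.\<close>

lemma card_of_edge_closure_under: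
  assumes "bounded_codegree k r E" "\<And>A. A \<in> E \<Longrightarrow> countable A" "uncountable V" "a \<in> V"
  shows "|edge_closure k E (under |V| a)| <o |V|"
proof (cases "finite (underS |V| a)")
  case True
  have un: "under |V| a \<subseteq> underS |V| a \<union> {a}" by (auto simp: under_def underS_def)
  then have "finite (under |V| a)" by (rule finite_subset) (simp add: True)
  then have "|under |V| a| \<le>o |UNIV :: nat set|"
    by (intro countable_card_of_ordLeq_infinite) (auto intro: countable_finite)
  then have "|edge_closure k E (under |V| a)| \<le>o |UNIV :: nat set|"
    using card_of_edge_closure[OF assms(1,2)] infinite_UNIV_nat by blast
  also have "|UNIV :: nat set| <o |V|"
    using assms(3) not_ordLeq_iff_ordLess[OF card_of_Well_order card_of_Well_order]
      card_of_ordLeq[of V "UNIV :: nat set"] unfolding countable_def by blast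
  finally show ?thesis .
next
  case False
  have un: "under |V| a \<subseteq> underS |V| a \<union> {a}" by (auto simp: under_def underS_def)
  have "|{a}| \<le>o |underS |V| a|"
    by (rule countable_card_of_ordLeq_infinite[OF _ False]) simp
  then have "|underS |V| a \<union> {a}| \<le>o |underS |V| a|"
    by (rule card_of_Un_ordLeq_infinite[OF False card_of_mono1[OF subset_refl]])
  then have "|under |V| a| \<le>o |underS |V| a|"
    using card_of_mono1[OF un] ordLeq_transitive by blast
  then have "|edge_closure k E (under |V| a)| \<le>o |underS |V| a|"
    using card_of_edge_closure[OF assms(1,2)] False by blast
  also have "|underS |V| a| <o |V|"
    using card_of_underS[OF card_of_Card_order] assms(4) by (simp add: Field_card_of)
  finally show ?thesis .
qed

text \<open>An uncountable \<open>V\<close> is exhausted by the closures of the initial segments of a well-order of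
  type \<open>|V|\<close>. By closedness an edge contained in one of them, but in no earlier one, has fewer
  than \<open>k\<close> vertices in the earlier ones, so its greatest element may be sought in the last block.\<close>

lemma maximizing_order:
  assumes "0 < k" "bounded_codegree k r E"
    "\<And>A. A \<in> E \<Longrightarrow> infinite A \<and> countable A \<and> A \<subseteq> V"
  shows "\<exists>S. wf S \<and> total_on V S \<and> (\<forall>A\<in>E. has_greatest S A)"
  using wf_inv_image[OF wf_ordLess, of card_of] assms(2,3)
proof (induction V arbitrary: E rule: wf_induct_rule)
  case (less V)
  show ?case
  proof (cases "countable V")
    case True
    then show ?thesis
      using maximizing_order_countable[OF less.prems(1)] less.prems(2) by (meson total_on_subset subset_UNIV)
  next
    case False
    define R where "R = |V| - Id"
    have wo: "well_order_on V |V|" by (rule card_of_well_order_on)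
    have R: "wf R" "total_on V R" and refl: "\<And>a. a \<in> V \<Longrightarrow> (a, a) \<in> |V|" and tr: "trans |V|"
      and dom: "|V| \<subseteq> V \<times> V"
      using wo by (auto simp: well_order_on_def linear_order_on_def partial_order_on_def
          preorder_on_def total_on_def R_def refl_on_def)
    have R_sub: "a \<in> V \<and> (a, b) \<in> |V|" if "(a, b) \<in> R" for a b
      using that dom by (auto simp: R_def)
    define C where "C a = edge_closure k E (under |V| a)" for a
    have C_mono: "C a \<subseteq> C b" if "(a, b) \<in> |V|" for a b
      unfolding C_def using that tr
      by (intro edge_closure_mono) (auto simp: under_def dest: transD)
    have C_self: "a \<in> C a" if "a \<in> V" for a
      using subset_edge_closure refl[OF that] by (fastforce simp: C_def under_def)
    have C_sub: "C a \<subseteq> V" for a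
      unfolding C_def using less.prems(2) dom
      by (intro edge_closure_subset) (auto simp: under_def)
    have C_closed: "A \<subseteq> C a" if "A \<in> E" "K \<subseteq> C a \<inter> A" "finite K" "card K = k" for A K a
      using edge_closure_closed[of A E K k] that unfolding C_def by blast
    \<comment> \<open>Every vertex lies in some \<open>C a\<close>; \<open>\<rho>\<close> will pick
      the first such index, and its fibres are the blocks \<open>W a\<close>.\<close>
    have "\<exists>a. a \<in> V \<and> x \<in> C a \<and> (\<forall>b. (b, a) \<in> R \<longrightarrow> x \<notin> C b)" if "x \<in> V" for x
    proof -
      have "x \<in> {a\<in>V. x \<in> C a}" using that C_self by blast
      from wfE_min[OF R(1) this] obtain a where
        "a \<in> {a\<in>V. x \<in> C a}" "\<And>b. (b, a) \<in> R \<Longrightarrow> b \<notin> {a\<in>V. x \<in> C a}" by blast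
      then show ?thesis using R_sub by (intro exI[of _ a]) blast
    qed
    then obtain \<rho> where \<rho>: "\<And>x. x \<in> V \<Longrightarrow> \<rho> x \<in> V" "\<And>x. x \<in> V \<Longrightarrow> x \<in> C (\<rho> x)"
      "\<And>x b. x \<in> V \<Longrightarrow> (b, \<rho> x) \<in> R \<Longrightarrow> x \<notin> C b" by metis
    have \<rho>_le: "\<rho> x = a \<or> (\<rho> x, a) \<in> R" if "a \<in> V" "x \<in> C a" for x a
    proof -
      have "x \<in> V" using that C_sub by blast
      then show ?thesis using \<rho>(1,3)[of x] R(2) that by (auto simp: total_on_def)
    qed
    define W where "W a = {x\<in>V. \<rho> x = a}" for a
    have greatest: "\<exists>b\<in>B. \<forall>x\<in>B. (x, b) \<in> |V|" if B: "finite B" "B \<noteq> {}" "B \<subseteq> V" for B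
    proof -
      obtain x where x: "x \<in> B" using B by blast
      have "has_greatest R {x}" by (simp add: has_greatest_def)
      then have "has_greatest R ({x} \<union> B)"
        using has_greatest_finite_Un[OF R _ B(1)] x B(3) by blast
      moreover have "{x} \<union> B = B" using x by blast
      ultimately obtain b where "b \<in> B" "\<forall>x\<in>B. x = b \<or> (x, b) \<in> R"
        unfolding has_greatest_def by auto
      moreover have "(b, b) \<in> |V|" using \<open>b \<in> B\<close> B(3) refl by blast
      ultimately show ?thesis unfolding R_def by (intro bexI[of _ b]) auto
    qed
    have block: "\<exists>a\<in>V. A \<subseteq> C a \<and> finite (A - W a)" if A: "A \<in> E" for A
    proof -
      have AV: "infinite A" "A \<subseteq> V" using less.prems(2)[OF A] by auto
      obtain K where K: "K \<subseteq> A" "finite K" "card K = k"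
        using infinite_arbitrarily_large[OF AV(1)] by blast
      \<comment> \<open>The greatest \<open>b\<close> of \<open>k\<close> vertices of
        \<open>A\<close> has all of them in \<open>C b\<close>, hence
        \<open>A \<subseteq> C b\<close>. It exists because \<open>k\<close> is positive.\<close>
      then obtain b where b: "b \<in> K" "\<forall>x\<in>K. (x, b) \<in> |V|"
        using greatest[of K] AV(2) assms(1) by fastforce
      have "K \<subseteq> C b" using b C_mono C_self K(1) AV(2) by blast
      then have "b \<in> {a\<in>V. A \<subseteq> C a}" using C_closed[OF A _ K(2,3)] K(1) b(1) AV(2) by blast
      from wfE_min[OF R(1) this] obtain a where a: "a \<in> V" "A \<subseteq> C a"
        "\<And>b. (b, a) \<in> R \<Longrightarrow> b \<notin> {a\<in>V. A \<subseteq> C a}"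
        by blast
      have "finite (A - W a)"
      proof (rule ccontr)
        assume "infinite (A - W a)"
        then obtain K where K: "K \<subseteq> A - W a" "finite K" "card K = k"
          using infinite_arbitrarily_large by blast
        have KV: "K \<subseteq> V" using K(1) AV(2) by blast
        have "K \<noteq> {}" using K(3) assms(1) by auto
        then obtain b where b: "b \<in> \<rho> ` K" "\<forall>x\<in>\<rho> ` K. (x, b) \<in> |V|"
          using greatest[of "\<rho> ` K"] K(2) \<rho>(1) KV by blast
        have "x \<in> C b" if "x \<in> K" for x
          using that b(2) C_mono \<rho>(2) KV by blast
        then have "A \<subseteq> C b" using C_closed[OF A _ K(2,3)] K(1) by blast
        moreover have "(b, a) \<in> R"
          using b(1) K(1) \<rho>_le[OF a(1)] a(2) KV unfolding W_def by blast
        ultimately show False using a(3) R_sub by blast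
      qed
      with a show ?thesis by blast
    qed
    have "\<exists>S. wf S \<and> total_on (W a) S \<and>
        (\<forall>A\<in>E. finite (A - W a) \<longrightarrow> has_greatest S (A \<inter> W a))" for a
    proof (cases "a \<in> V")
      case False
      then have "W a = {}" using \<rho>(1) by (auto simp: W_def)
      \<comment> \<open>\<open>wf_lex_sum\<close> asks for well-foundedness at every index. Outside
        \<open>V\<close> the empty relation serves: no edge \<open>A\<close> qualifies, as
        \<open>A - {}\<close> is infinite.\<close>
      then show ?thesis using less.prems(2) by (intro exI[of _ "{}"]) auto
    next
      case True
      \<comment> \<open>The induction hypothesis is applied to traces of edges. Losing finitely many
        vertices keeps them infinite, and distinct traces come from distinct edges, so codegrees do
        not grow.\<close>
      define E' where "E' = (\<lambda>A. A \<inter> W a) ` {A\<in>E. finite (A - W a)}"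
      have "W a \<subseteq> C a" using \<rho>(2) by (auto simp: W_def)
      moreover have "|C a| <o |V|" unfolding C_def
        using card_of_edge_closure_under[OF less.prems(1) _ False True] less.prems(2) by blast
      ultimately have "|W a| <o |V|" using card_of_mono1 ordLeq_ordLess_trans by blast
      moreover have "bounded_codegree k r E'"
        unfolding bounded_codegree_def
      proof (intro allI impI)
        fix K :: "'a set" assume K: "finite K \<and> card K = k"
        have sub: "{B\<in>E'. K \<subseteq> B} \<subseteq> (\<lambda>A. A \<inter> W a) ` {A\<in>E. K \<subseteq> A}" by (auto simp: E'_def)
        have fin: "finite {A\<in>E. K \<subseteq> A}" "card {A\<in>E. K \<subseteq> A} \<le> r"
          using less.prems(1) K by (auto simp: bounded_codegree_def)
        show "finite {B\<in>E'. K \<subseteq> B} \<and> card {B\<in>E'. K \<subseteq> B} \<le> r"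
          using sub fin surj_card_le[OF fin(1) sub] finite_surj[OF fin(1) sub] by linarith
      qed
      moreover have "infinite B \<and> countable B \<and> B \<subseteq> W a" if "B \<in> E'" for B
      proof -
        obtain A where A: "B = A \<inter> W a" "A \<in> E" "finite (A - W a)" using \<open>B \<in> E'\<close> by (auto simp: E'_def)
        then have "infinite (A - (A - W a))" using less.prems(2) by (metis Diff_infinite_finite)
        then show ?thesis using A less.prems(2)[OF A(2)] by (simp add: Diff_Diff_Int)
      qed
      ultimately have "\<exists>S. wf S \<and> total_on (W a) S \<and> (\<forall>B\<in>E'. has_greatest S B)"
        by (intro less.IH) auto
      then show ?thesis by (auto simp: E'_def)
    qed
    then obtain S where S: "\<And>a. wf (S a)" "\<And>a. total_on (W a) (S a)"
      "\<And>a A. A \<in> E \<Longrightarrow> finite (A - W a) \<Longrightarrow> has_greatest (S a) (A \<inter> W a)" by metis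
    define L where "L = lex_sum \<rho> R S"
    have "wf L" unfolding L_def by (intro wf_lex_sum R(1) S(1))
    moreover have "total_on V L" unfolding L_def
      using S(2) R(2) \<rho>(1) by (intro total_on_lex_sum) (auto simp: W_def total_on_def)
    moreover have "has_greatest L A" if A: "A \<in> E" for A
    proof -
      obtain a where a: "a \<in> V" "A \<subseteq> C a" "finite (A - W a)" using block[OF A] by blast
      obtain m where m: "m \<in> A \<inter> W a" "\<forall>x\<in>A \<inter> W a. x = m \<or> (x, m) \<in> S a"
        using S(3)[OF A a(3)] unfolding has_greatest_def by blast
      \<comment> \<open>Vertices of \<open>A\<close> outside \<open>W a\<close> have an earlier
        index because \<open>A \<subseteq> C a\<close>, so they lie below \<open>m\<close>.\<close>
      have "x = m \<or> (x, m) \<in> L" if "x \<in> A" for x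
      proof -
        have xm: "x \<in> V" "\<rho> m = a" "\<rho> x = a \<or> (\<rho> x, a) \<in> R"
          using that \<rho>_le[OF a(1), of x] a(2) m(1) less.prems(2)[OF A] by (auto simp: W_def)
        then show ?thesis using m(2) that unfolding L_def lex_sum_def W_def by auto
      qed
      with m(1) show ?thesis unfolding has_greatest_def by blast
    qed
    ultimately show ?thesis by blast
  qed
qed

section \<open>Property C and maximizing orders\<close>

lemma card_of_finite_ordIso_natLeq_on:
  assumes "finite A"
  shows "|A| =o natLeq_on (card A)"
proof -
  have eq: "{0..<card A} = {x. x < card A}" by auto
  obtain h where "bij_betw h A {x. x < card A}"
    using ex_bij_betw_finite_nat[OF assms] unfolding eq by (elim exE)
  then have "|A| =o |{x. x < card A}|" using card_of_ordIso by blast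
  also have "|{x. x < card A}| =o natLeq_on (card A)"
    by (rule finite_well_order_on_ordIso[OF _ card_of_well_order_on natLeq_on_well_order_on]) simp
  finally show ?thesis .
qed

text \<open>If more than \<open>r\<close> edges contained \<open>K\<close>, then \<open>r\<close> of
  them would share the \<open>k\<close> points of \<open>K\<close>.\<close>

lemma property_C_bounded_codegree:
  assumes "property_C (natLeq_on r) (natLeq_on k) E"
  shows "bounded_codegree k r E"
  unfolding bounded_codegree_def
proof (intro allI impI)
  fix K :: "'a set" assume K: "finite K \<and> card K = k"
  show "finite {A\<in>E. K \<subseteq> A} \<and> card {A\<in>E. K \<subseteq> A} \<le> r"
  proof (rule ccontr)
    assume neg: "\<not> ?thesis"
    have "\<exists>E'\<subseteq>{A\<in>E. K \<subseteq> A}. finite E' \<and> card E' = r"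
    proof (cases "finite {A\<in>E. K \<subseteq> A}")
      case True
      then have "r \<le> card {A\<in>E. K \<subseteq> A}" using neg by simp
      then obtain E' where "E' \<subseteq> {A\<in>E. K \<subseteq> A}" "card E' = r" "finite E'"
        by (rule obtain_subset_with_card_n)
      then show ?thesis by (intro exI[of _ E'] conjI)
    next
      case False
      from infinite_arbitrarily_large[OF this, of r]
      obtain E' where "finite E' \<and> card E' = r \<and> E' \<subseteq> {A\<in>E. K \<subseteq> A}" by (elim exE)
      then show ?thesis by (intro exI[of _ E'] conjI) simp_all
    qed
    then obtain E' where E': "E' \<subseteq> {A\<in>E. K \<subseteq> A}" "finite E'" "card E' = r" by blast
    \<comment> \<open>If \<open>r = 0\<close>, then \<open>E'\<close> is empty and
      \<open>\<Inter>E'\<close> is the universe, so \<open>K \<subseteq> \<Union>E\<close> has to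
      come from an edge through \<open>K\<close>.\<close>
    have "{A\<in>E. K \<subseteq> A} \<noteq> {}"
    proof
      assume empty: "{A\<in>E. K \<subseteq> A} = {}"
      show False using neg unfolding empty by simp
    qed
    then have "K \<subseteq> \<Union>E \<inter> \<Inter>E'" using E'(1) by blast
    then have "|K| \<le>o |\<Union>E \<inter> \<Inter>E'|" by (rule card_of_mono1)
    also have "|\<Union>E \<inter> \<Inter>E'| <o natLeq_on k"
    proof -
      have "|E'| =o natLeq_on r" using card_of_finite_ordIso_natLeq_on[OF E'(2)] E'(3) by simp
      moreover have "E' \<subseteq> E" using E'(1) by blast
      ultimately show ?thesis using assms by (simp add: property_C_def)
    qed
    also have "natLeq_on k =o |K|"
      using ordIso_symmetric[OF card_of_finite_ordIso_natLeq_on[of K]] K by simp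
    finally show False using ordLess_irreflexive by blast
  qed
qed

text \<open>Raising \<open>k\<close> by one makes it positive, as \<open>maximizing_order\<close>
  requires.\<close>

lemma bounded_codegree_Suc:
  assumes "bounded_codegree k r E"
  shows "bounded_codegree (Suc k) r E"
  unfolding bounded_codegree_def
proof (intro allI impI)
  fix K :: "'a set" assume K: "finite K \<and> card K = Suc k"
  then obtain L where "L \<subseteq> K" "finite L" "card L = k"
    by (metis obtain_subset_with_card_n le_SucI order_refl)
  then have sub: "{A\<in>E. K \<subseteq> A} \<subseteq> {A\<in>E. L \<subseteq> A}"
    and fin: "finite {A\<in>E. L \<subseteq> A}" "card {A\<in>E. L \<subseteq> A} \<le> r"
    using assms by (auto simp: bounded_codegree_def)
  show "finite {A\<in>E. K \<subseteq> A} \<and> card {A\<in>E. K \<subseteq> A} \<le> r"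
    using finite_subset[OF sub fin(1)] card_mono[OF fin(1) sub] fin(2) by linarith
qed

text \<open>\<open>R\<close> is the reflexive form of \<open>S\<close> on the vertices. A greatest
  element is maximal because \<open>S\<close> is asymmetric.\<close>

lemma maximizing_well_orderingI:
  assumes "wf S" "total_on (\<Union>E) S" "\<And>A. A \<in> E \<Longrightarrow> has_greatest S A"
  shows "\<exists>R. maximizing_well_ordering E R"
proof -
  define V where "V = \<Union>E"
  define R where "R = {(x, y). x \<in> V \<and> y \<in> V \<and> (x = y \<or> (x, y) \<in> S)}"
  have asym: "(y, x) \<notin> S" if "(x, y) \<in> S" for x y using assms(1) that by (rule wf_not_sym)
  have tot: "total_on V S" using assms(2) by (simp add: V_def)
  have "R \<subseteq> V \<times> V" "refl_on V R" "antisym R" "total_on V R"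
    using asym tot by (auto simp: R_def refl_on_def antisym_def total_on_def)
  moreover have "trans R"
  proof (rule transI)
    fix x y z assume "(x, y) \<in> R" "(y, z) \<in> R"
    then show "(x, z) \<in> R" using wf_total_trans[OF assms(1) tot, of x z y] by (auto simp: R_def)
  qed
  moreover have "wf (R - Id)" by (rule wf_subset[OF assms(1)]) (auto simp: R_def)
  ultimately have "well_order_on V R"
    by (simp add: well_order_on_def linear_order_on_def partial_order_on_def preorder_on_def)
  moreover have "\<exists>a\<in>A. \<forall>x\<in>A. (a, x) \<in> R \<longrightarrow> x = a" if "A \<in> E" for A
    using assms(3)[OF that] asym unfolding has_greatest_def R_def by blast
  ultimately show ?thesis unfolding maximizing_well_ordering_def V_def by blast
qed

theorem theorem4p1:
  fixes lam :: "'a rel" and E :: "'a set set" and k r :: nat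
  assumes "Card_order lam" and "natLeq \<le>o lam"
    and "hypergraph E"
    and "E \<subseteq> subsets_of_card (Field lam) natLeq"
    and "property_C (natLeq_on r) (natLeq_on k) E"
  shows "\<exists>R. maximizing_well_ordering E R"
proof -
  have "infinite A \<and> countable A \<and> A \<subseteq> \<Union>E" if "A \<in> E" for A
  proof -
    have "|A| =o natLeq" using assms(4) that by (auto simp: subsets_of_card_def)
    then have iso: "|A| =o |UNIV :: nat set|"
      using card_of_nat ordIso_symmetric ordIso_transitive by blast
    then have "infinite A" using card_of_ordIso_finite infinite_UNIV_nat by blast
    moreover have "countable A"
      using iso unfolding card_of_ordIso[symmetric] bij_betw_def countable_def by blast
    ultimately show ?thesis using that by blast
  qed
  then show ?thesis
    using maximizing_order[OF zero_less_Suc bounded_codegree_Suc[OF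
          property_C_bounded_codegree[OF assms(5)]], of "\<Union>E"] maximizing_well_orderingI
    by blast
qed

end
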